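(* Let $n\ge1$ and let $G_n$ be the linear crossed polyomino chain with $n$ four-order complete graphs. Then its Kirchhoff index is $$K\!f(G_n)=\frac{(n+1)(n+2)^2}{6}.$$
   Context: For $n\geq1$, $G_n$ is the simple graph with vertex set $\{1,\ldots,n+1\}\cup\{1',\ldots,(n+1)'\}$ and edge set consisting of the vertical edges $ii'$ for $1\le i\le n+1$ together with, for each $1\le i\le n$, the edges $i(i+1)$, $i'(i+1)'$, $i(i+1)'$, $i'(i+1)$. The resistance distance $r_{uv}$ is the effective resistance between $u$ and $v$ when each edge is a unit resistor, and the Kirchhoff index is $K\!f(G)=\sum_{\{u,v\}} r_{uv}$, summed over unordered pairs of distinct vertices. *)

theory Defs
  imports Complex_Main
begin

text \<open>A simple graph is given by its vertex set \<open>V\<close> and its set \<open>E\<close> of two-element subsets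
  of \<open>V\<close>.\<close>

text \<open>\<open>f\<close> is an electric potential on the network \<open>(V, E)\<close> (unit resistor on every edge) when a
  current of size one enters at \<open>u\<close> and leaves at \<open>v\<close>: by Ohm's law the current from \<open>x\<close> to a
  neighbour \<open>y\<close> is \<open>f x - f y\<close>, and Kirchhoff's current law prescribes the net outflow at
  every vertex.\<close>

definition unit_current_potential ::
    "'a set \<Rightarrow> 'a set set \<Rightarrow> 'a \<Rightarrow> 'a \<Rightarrow> ('a \<Rightarrow> real) \<Rightarrow> bool" where
  "unit_current_potential V E u v f \<longleftrightarrow>
     (\<forall>x\<in>V. (\<Sum>y\<in>{y\<in>V. {x, y} \<in> E}. f x - f y) =
              (if x = u then 1 else 0) - (if x = v then 1 else 0))"

text \<open>The potential is not unique, but the potential difference between \<open>u\<close> and \<open>v\<close> is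
  (see \<open>effective_resistance_eqI\<close>).\<close>

definition effective_resistance :: "'a set \<Rightarrow> 'a set set \<Rightarrow> 'a \<Rightarrow> 'a \<Rightarrow> real" where
  "effective_resistance V E u v =
     (THE r. \<exists>f. unit_current_potential V E u v f \<and> r = f u - f v)"

text \<open>The inner description passes from the unordered pair \<open>e\<close> to either of its orderings; this
  is legitimate by \<open>effective_resistance_commute\<close>.\<close>

definition kirchhoff_index :: "'a set \<Rightarrow> 'a set set \<Rightarrow> real" where
  "kirchhoff_index V E =
     (\<Sum>e\<in>{e. e \<subseteq> V \<and> card e = 2}.
        THE r. \<exists>u v. e = {u, v} \<and> r = effective_resistance V E u v)"

text \<open>The vertex \<open>i\<close> of the chain is \<open>Inl i\<close>, and \<open>i'\<close> is \<open>Inr i\<close>.\<close>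

definition crossed_chain_verts :: "nat \<Rightarrow> (nat + nat) set" where
  "crossed_chain_verts n = {1..n+1} <+> {1..n+1}"

definition crossed_chain_edges :: "nat \<Rightarrow> (nat + nat) set set" where
  "crossed_chain_edges n =
     {{Inl i, Inr i} | i. i \<in> {1..n+1}} \<union>
     {{Inl i, Inl (i+1)} | i. i \<in> {1..n}} \<union>
     {{Inr i, Inr (i+1)} | i. i \<in> {1..n}} \<union>
     {{Inl i, Inr (i+1)} | i. i \<in> {1..n}} \<union>
     {{Inr i, Inl (i+1)} | i. i \<in> {1..n}}"

lemma crossed_chain_simple:
  "e \<in> crossed_chain_edges n \<Longrightarrow> e \<subseteq> crossed_chain_verts n \<and> card e = 2"
  by (auto simp: crossed_chain_edges_def crossed_chain_verts_def)

lemma unit_current_potential_unique: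
  assumes "finite V" "u \<in> V" "v \<in> V"
    and f: "unit_current_potential V E u v f"
    and g: "unit_current_potential V E u v g"
  shows "f u - f v = g u - g v"
proof -
  define a :: "'a \<Rightarrow> 'a \<Rightarrow> real" where "a x y = (if {x, y} \<in> E then 1 else 0)" for x y
  define b :: "'a \<Rightarrow> real" where
    "b x = (if x = u then 1 else 0) - (if x = v then 1 else 0)" for x
  have pair: "(\<Sum>x\<in>V. h x * b x) = h u - h v" for h :: "'a \<Rightarrow> real"
  proof -
    have "h x * b x = (if x = u then h x else 0) - (if x = v then h x else 0)" for x
      by (simp add: b_def)
    then show ?thesis
      using assms(1-3) by (simp add: sum_subtractf)
  qed
  have kcl: "(\<Sum>y\<in>V. a x y * (h x - h y)) = b x"
    if "unit_current_potential V E u v h" "x \<in> V" for h x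
  proof -
    have "(\<Sum>y\<in>V. a x y * (h x - h y)) = (\<Sum>y\<in>V. if {x, y} \<in> E then h x - h y else 0)"
      by (rule sum.cong) (simp_all add: a_def)
    also have "\<dots> = (\<Sum>y\<in>{y\<in>V. {x, y} \<in> E}. h x - h y)"
      using assms(1) by (simp add: sum.inter_filter)
    also have "\<dots> = b x"
      using that by (simp only: unit_current_potential_def b_def)
    finally show ?thesis .
  qed
  have a_sym: "a x y = a y x" for x y
    by (simp add: a_def insert_commute)
  have "(\<Sum>x\<in>V. f x * b x) = (\<Sum>x\<in>V. \<Sum>y\<in>V. a x y * (f x * g x)) - (\<Sum>x\<in>V. \<Sum>y\<in>V. a x y * (f x * g y))"
    by (simp add: kcl[OF g, symmetric] sum_distrib_left sum_subtractf algebra_simps)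
  also have "(\<Sum>x\<in>V. \<Sum>y\<in>V. a x y * (f x * g y)) = (\<Sum>x\<in>V. \<Sum>y\<in>V. a x y * (g x * f y))"
    by (subst sum.swap) (simp add: a_sym mult.commute)
  also have "(\<Sum>x\<in>V. \<Sum>y\<in>V. a x y * (f x * g x)) - \<dots> = (\<Sum>x\<in>V. g x * b x)"
    by (simp add: kcl[OF f, symmetric] sum_distrib_left sum_subtractf algebra_simps)
  finally show ?thesis
    by (simp add: pair)
qed

lemma effective_resistance_eqI:
  assumes "finite V" "u \<in> V" "v \<in> V" "unit_current_potential V E u v f"
  shows "effective_resistance V E u v = f u - f v"
  unfolding effective_resistance_def
proof (rule the_equality)
  show "\<exists>g. unit_current_potential V E u v g \<and> f u - f v = g u - g v"
    by (rule exI[of _ f]) (simp add: assms(4))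
  show "r = f u - f v"
    if "\<exists>g. unit_current_potential V E u v g \<and> r = g u - g v" for r
    using that unit_current_potential_unique[OF assms(1-3) _ assms(4)] by (elim exE conjE) simp
qed

lemma unit_current_potential_uminus:
  assumes "unit_current_potential V E u v f"
  shows "unit_current_potential V E v u (\<lambda>x. - f x)"
  unfolding unit_current_potential_def
proof
  fix x assume "x \<in> V"
  have "(\<Sum>y\<in>{y\<in>V. {x, y} \<in> E}. - f x - - f y) = - (\<Sum>y\<in>{y\<in>V. {x, y} \<in> E}. f x - f y)"
    by (simp flip: sum_negf)
  then show "(\<Sum>y\<in>{y\<in>V. {x, y} \<in> E}. - f x - - f y) =
      (if x = v then 1 else 0) - (if x = u then 1 else 0)"
    using assms \<open>x \<in> V\<close> by (simp add: unit_current_potential_def)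
qed

lemma effective_resistance_commute:
  "effective_resistance V E u v = effective_resistance V E v u"
proof -
  have "\<exists>g. unit_current_potential V E t s g \<and> r = g t - g s"
    if "\<exists>f. unit_current_potential V E s t f \<and> r = f s - f t" for s t r
  proof -
    from that obtain f where "unit_current_potential V E s t f" "r = f s - f t"
      by (elim exE conjE)
    then show ?thesis
      by (intro exI[of _ "\<lambda>x. - f x"]) (simp add: unit_current_potential_uminus)
  qed
  then have "(\<exists>f. unit_current_potential V E u v f \<and> r = f u - f v) \<longleftrightarrow>
      (\<exists>f. unit_current_potential V E v u f \<and> r = f v - f u)" for r
    by (intro iffI)
  then show ?thesis
    by (simp only: effective_resistance_def)
qed

lemma the_pair_resistance:
  "(THE r. \<exists>s t. {u, v} = {s, t} \<and> r = effective_resistance V E s t) =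
     effective_resistance V E u v"
proof (rule the_equality)
  show "\<exists>s t. {u, v} = {s, t} \<and>
      effective_resistance V E u v = effective_resistance V E s t"
    by (intro exI conjI) (rule refl)+
next
  fix r assume "\<exists>s t. {u, v} = {s, t} \<and> r = effective_resistance V E s t"
  then obtain s t where "{u, v} = {s, t}" and r: "r = effective_resistance V E s t"
    by (elim exE conjE)
  then consider "s = u" "t = v" | "s = v" "t = u"
    by (auto simp: doubleton_eq_iff)
  then show "r = effective_resistance V E u v"
  proof cases
    case 1
    then show ?thesis by (simp only: r)
  next
    case 2
    show ?thesis unfolding r 2 by (rule effective_resistance_commute)
  qed
qed

end

theory Submission
  imports Defs
begin

text \<open>The Laplacian respects the splitting of a function on the chain into its column means
  and its differences inside the columns: on the means it acts like the Laplacian of a path, and on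
  the differences it is diagonal. This gives an explicit function \<open>chain_green n u\<close> whose
  Laplacian is the point source at \<open>u\<close> up to a term not depending on \<open>u\<close>, and all
  resistances can be read off from differences of two such functions.\<close>

fun mate :: "'a + 'a \<Rightarrow> 'a + 'a" where
  "mate (Inl i) = Inr i"
| "mate (Inr i) = Inl i"

fun column :: "'a + 'a \<Rightarrow> 'a" where
  "column (Inl i) = i"
| "column (Inr i) = i"

text \<open>The value is \<open>1 / (4 * (1 + k))\<close>, where \<open>k\<close> is the number of columns adjacent
  to column \<open>i\<close>.\<close>

definition column_weight :: "nat \<Rightarrow> nat \<Rightarrow> real" where
  "column_weight n i = (if i = 1 \<or> i = n + 1 then 1/8 else 1/12)"

text \<open>The unit source at \<open>u\<close> is half the indicator of its column plus half the
  difference inside that column. An in-column difference is multiplied by 2(1 + k), k being the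
  number of adjacent columns, which gives \<open>column_weight\<close>. A function of the column
  gets twice the path Laplacian, so the kink of -|i - a|/8 at an interior column a yields
  1/2.\<close>

definition chain_green :: "nat \<Rightarrow> nat + nat \<Rightarrow> nat + nat \<Rightarrow> real" where
  "chain_green n u x =
     (if x = u then column_weight n (column u)
      else if x = mate u then - column_weight n (column u) else 0)
     - \<bar>real (column x) - real (column u)\<bar> / 8"

lemma finite_crossed_chain_verts [simp]: "finite (crossed_chain_verts n)"
  by (simp add: crossed_chain_verts_def)

lemma sum_crossed_chain_verts:
  "(\<Sum>x\<in>crossed_chain_verts n. F x) = (\<Sum>i\<in>{1..n+1}. F (Inl i) + F (Inr i))"
  by (simp add: crossed_chain_verts_def sum.Plus sum.distrib)

lemma crossed_chain_neighbours:
  assumes "x \<in> crossed_chain_verts n"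
  shows "{y \<in> crossed_chain_verts n. {x, y} \<in> crossed_chain_edges n} =
     insert (mate x)
       ((if column x > 1 then {Inl (column x - 1), Inr (column x - 1)} else {}) \<union>
        (if column x \<le> n then {Inl (column x + 1), Inr (column x + 1)} else {}))"
proof -
  \<comment> \<open>With the column in the form \<open>Suc k\<close>, the truncated subtraction
    \<open>column x - 1\<close> is simply \<open>k\<close>.\<close>
  obtain k where "column x = Suc k"
    using assms by (cases x; cases "column x") (auto simp: crossed_chain_verts_def)
  with assms show ?thesis
    by (cases x) (auto simp: crossed_chain_verts_def crossed_chain_edges_def doubleton_eq_iff
        ex_disj_distrib conj_disj_distribL)
qed

lemma sum_crossed_chain_neighbours:
  fixes F :: "nat + nat \<Rightarrow> real"
  assumes "x \<in> crossed_chain_verts n"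
  shows "(\<Sum>y\<in>{y \<in> crossed_chain_verts n. {x, y} \<in> crossed_chain_edges n}. F y) =
     F (mate x)
     + (if column x > 1 then F (Inl (column x - 1)) + F (Inr (column x - 1)) else 0)
     + (if column x \<le> n then F (Inl (column x + 1)) + F (Inr (column x + 1)) else 0)"
  unfolding crossed_chain_neighbours[OF assms] by (cases x) auto

text \<open>The unit current entering at \<open>u\<close> leaves in equal quarters through the four
  end vertices, whatever \<open>u\<close> is. For \<open>n \<ge> 1\<close> the two end columns are
  distinct.\<close>

lemma chain_green_laplacian:
  assumes "n \<ge> 1" and x: "x \<in> crossed_chain_verts n" and u: "u \<in> crossed_chain_verts n"
  shows "(\<Sum>y\<in>{y \<in> crossed_chain_verts n. {x, y} \<in> crossed_chain_edges n}.
            chain_green n u x - chain_green n u y) =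
         (if x = u then 1 else 0) - (if column x = 1 \<or> column x = n + 1 then 1/4 else 0)"
proof -
  define i a where "i = column x" and "a = column u"
  have ia: "1 \<le> i" "i \<le> n + 1" "1 \<le> a" "a \<le> n + 1"
    using x u by (auto simp: i_def a_def crossed_chain_verts_def)
  \<comment> \<open>The difference part cancels over a column, leaving twice the column
    mean.\<close>
  have sum_column: "chain_green n u (Inl j) + chain_green n u (Inr j) =
      - \<bar>real j - real a\<bar> / 4" for j
    by (cases u) (auto simp: chain_green_def a_def)
  define d where "d = (if x = u then column_weight n a
      else if x = mate u then - column_weight n a else 0)"
  have gx: "chain_green n u x = d - \<bar>real i - real a\<bar> / 8"
    by (simp add: chain_green_def d_def i_def a_def)
  have gm: "chain_green n u (mate x) = - d - \<bar>real i - real a\<bar> / 8"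
    by (cases u; cases x) (auto simp: chain_green_def d_def i_def a_def)
  have d: "d = (if i = a then (if x = u then 1 else - 1) * column_weight n i else 0)"
    by (cases u; cases x) (auto simp: d_def i_def a_def)
  have neq: "x \<noteq> u" if "i \<noteq> a"
    using that by (auto simp: i_def a_def)
  have pair: "(chain_green n u x - chain_green n u (Inl j)) +
      (chain_green n u x - chain_green n u (Inr j)) =
      2 * d - \<bar>real i - real a\<bar> / 4 + \<bar>real j - real a\<bar> / 4" for j
    using sum_column[of j] gx by simp
  have "(\<Sum>y\<in>{y \<in> crossed_chain_verts n. {x, y} \<in> crossed_chain_edges n}.
            chain_green n u x - chain_green n u y) =
      2 * d
      + (if i > 1 then 2 * d - \<bar>real i - real a\<bar> / 4 + \<bar>real (i - 1) - real a\<bar> / 4 else 0)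
      + (if i \<le> n then 2 * d - \<bar>real i - real a\<bar> / 4 + \<bar>real (i + 1) - real a\<bar> / 4 else 0)"
    unfolding sum_crossed_chain_neighbours[OF x] i_def[symmetric] pair
    by (simp add: gx gm)
  also have "\<dots> = (if x = u then 1 else 0) - (if i = 1 \<or> i = n + 1 then 1/4 else 0)"
  proof -
    \<comment> \<open>Away from the source column the mean is affine, so only a missing neighbour at
      an end contributes; at \<open>i = a\<close> the kink and \<open>d\<close> each supply 1/2 of
      the source, less 1/4 for the mean at an end.\<close>
    consider "i < a" | "i = a" | "i > a" by linarith
    then show ?thesis
    proof cases
      case 1
      then have "real i + 1 \<le> real a" by linarith
      with 1 show ?thesis using ia assms(1) neq
        by (auto simp: d of_nat_diff abs_if field_simps)
    next
      case 2
      then show ?thesis using ia assms(1)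
        by (auto simp: d column_weight_def of_nat_diff abs_if)
    next
      case 3
      then have "real i - 1 \<ge> real a" by linarith
      with 3 show ?thesis using ia assms(1) neq
        by (auto simp: d of_nat_diff abs_if field_simps)
    qed
  qed
  finally show ?thesis by (simp add: i_def)
qed

text \<open>By superposition the two Green functions are subtracted and their common sinks cancel.
  For mates, each of the two cross terms adds one more \<open>column_weight\<close>.\<close>

lemma crossed_chain_resistance:
  assumes "n \<ge> 1" and u: "u \<in> crossed_chain_verts n" and v: "v \<in> crossed_chain_verts n"
  shows "effective_resistance (crossed_chain_verts n) (crossed_chain_edges n) u v =
    (if u = v then 0
     else column_weight n (column u) + column_weight n (column v)
       + \<bar>real (column u) - real (column v)\<bar> / 4
       + (if column u = column v then 2 * column_weight n (column u) else 0))"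
proof -
  let ?f = "\<lambda>x. chain_green n u x - chain_green n v x"
  have "(\<Sum>y\<in>{y \<in> crossed_chain_verts n. {x, y} \<in> crossed_chain_edges n}. ?f x - ?f y) =
      (if x = u then 1 else 0) - (if x = v then 1 else 0)"
    if x: "x \<in> crossed_chain_verts n" for x
  proof -
    have "(\<Sum>y\<in>{y \<in> crossed_chain_verts n. {x, y} \<in> crossed_chain_edges n}. ?f x - ?f y) =
      (\<Sum>y\<in>{y \<in> crossed_chain_verts n. {x, y} \<in> crossed_chain_edges n}.
            chain_green n u x - chain_green n u y) -
      (\<Sum>y\<in>{y \<in> crossed_chain_verts n. {x, y} \<in> crossed_chain_edges n}.
            chain_green n v x - chain_green n v y)"
      unfolding sum_subtractf[symmetric] by (rule sum.cong) simp_all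
    then show ?thesis
      by (simp only: chain_green_laplacian[OF assms(1) x u] chain_green_laplacian[OF assms(1) x v])
  qed
  then have "unit_current_potential (crossed_chain_verts n) (crossed_chain_edges n) u v ?f"
    by (simp add: unit_current_potential_def)
  from effective_resistance_eqI[OF finite_crossed_chain_verts u v this] show ?thesis
    by (cases u; cases v) (auto simp: chain_green_def abs_minus_commute)
qed

lemma sum_two_subsets:
  fixes g :: "'a set \<Rightarrow> 'b::comm_semiring_1"
  assumes "finite V"
  shows "2 * (\<Sum>e\<in>{e. e \<subseteq> V \<and> card e = 2}. g e) =
    (\<Sum>u\<in>V. \<Sum>v\<in>V. if u = v then 0 else g {u, v})"
proof -
  let ?T = "{e. e \<subseteq> V \<and> card e = 2}"
  let ?S = "{p \<in> V \<times> V. fst p \<noteq> snd p}"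
  let ?pair = "\<lambda>p. {fst p, snd p}"
  \<comment> \<open>Double counting: exactly two ordered pairs lie over each two-element
    subset.\<close>
  have fibre: "(\<Sum>p\<in>{p \<in> ?S. ?pair p = e}. g (?pair p)) = 2 * g e" if "e \<in> ?T" for e
  proof -
    from that obtain s t where e: "e = {s, t}" "s \<noteq> t" "s \<in> V" "t \<in> V"
      by (auto simp: card_2_iff)
    have "{p \<in> ?S. ?pair p = e} = {(s, t), (t, s)}"
      using e by (auto simp: doubleton_eq_iff)
    then show ?thesis
      using e by (simp add: insert_commute mult_2)
  qed
  have "2 * (\<Sum>e\<in>?T. g e) = (\<Sum>e\<in>?T. \<Sum>p\<in>{p \<in> ?S. ?pair p = e}. g (?pair p))"
    unfolding sum_distrib_left by (rule sum.cong) (simp_all only: fibre)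
  also have "\<dots> = (\<Sum>p\<in>?S. g (?pair p))"
    by (rule sum.group) (use assms in auto)
  also have "\<dots> = (\<Sum>p\<in>V \<times> V. if fst p \<noteq> snd p then g (?pair p) else 0)"
    by (rule sum.inter_filter) (use assms in auto)
  also have "\<dots> = (\<Sum>u\<in>V. \<Sum>v\<in>V. if u = v then 0 else g {u, v})"
    unfolding sum.cartesian_product by (rule sum.cong) auto
  finally show ?thesis .
qed

lemma kirchhoff_index_ordered:
  assumes "finite V"
  shows "2 * kirchhoff_index V E =
    (\<Sum>u\<in>V. \<Sum>v\<in>V. if u = v then 0 else effective_resistance V E u v)"
  unfolding kirchhoff_index_def sum_two_subsets[OF assms] the_pair_resistance ..

lemma sum_column_weight:
  assumes "n \<ge> 1"
  shows "(\<Sum>i\<in>{1..n+1}. column_weight n i) = (real n + 2) / 12"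
proof -
  \<comment> \<open>Each end exceeds the interior value by 1/8 - 1/12 = 1/24.\<close>
  have "(\<Sum>i\<in>{1..n+1}. column_weight n i) =
      (\<Sum>i\<in>{1..n+1}. 1/12 + (if i = 1 then 1/24 else 0) + (if i = n + 1 then 1/24 else 0))"
    by (rule sum.cong) (use assms in \<open>auto simp: column_weight_def\<close>)
  also have "\<dots> = (real n + 2) / 12"
    unfolding sum.distrib by (simp add: sum.delta field_simps del: sum.cl_ivl_Suc)
  finally show ?thesis .
qed

lemma sum_abs_differences:
  "(\<Sum>a\<in>{1..m}. \<Sum>b\<in>{1..m}. \<bar>real a - real b\<bar>) = (real m ^ 3 - real m) / 3"
proof (induction m)
  case 0
  then show ?case by simp
next
  case (Suc m)
  have row: "(\<Sum>b\<in>{1..m}. real (Suc m) - real b) = real m * (real m + 1) / 2" for m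
    by (induction m) (simp_all add: sum_subtractf field_simps)
  have r1: "(\<Sum>b\<in>{1..m}. \<bar>real (Suc m) - real b\<bar>) = real m * (real m + 1) / 2"
    unfolding row[symmetric] by (rule sum.cong) auto
  have r2: "(\<Sum>a\<in>{1..m}. \<bar>real a - real (Suc m)\<bar>) = real m * (real m + 1) / 2"
    unfolding r1[symmetric] by (rule sum.cong) auto
  \<comment> \<open>Enlarging the square adds a row and a column whose common corner is
    zero.\<close>
  have "(\<Sum>a\<in>{1..Suc m}. \<Sum>b\<in>{1..Suc m}. \<bar>real a - real b\<bar>) =
      (\<Sum>a\<in>{1..m}. \<Sum>b\<in>{1..m}. \<bar>real a - real b\<bar>)
      + (\<Sum>a\<in>{1..m}. \<bar>real a - real (Suc m)\<bar>) + (\<Sum>b\<in>{1..m}. \<bar>real (Suc m) - real b\<bar>)"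
    by (simp add: sum.distrib)
  then show ?case
    unfolding Suc.IH r1 r2 by (simp add: field_simps power3_eq_cube)
qed

theorem theorem3p1:
  fixes n :: nat
  assumes "n \<ge> 1"
  shows "kirchhoff_index (crossed_chain_verts n) (crossed_chain_edges n) =
           (real n + 1) * (real n + 2)^2 / 6"
proof -
  let ?V = "crossed_chain_verts n"
  let ?h = "column_weight n"
  let ?r = "effective_resistance ?V (crossed_chain_edges n)"
  have "2 * kirchhoff_index ?V (crossed_chain_edges n) =
      (\<Sum>u\<in>?V. \<Sum>v\<in>?V. if u = v then 0 else ?r u v)"
    by (rule kirchhoff_index_ordered) simp
  also have "\<dots> = (\<Sum>u\<in>?V. \<Sum>v\<in>?V. if u = v then 0
      else ?h (column u) + ?h (column v) + \<bar>real (column u) - real (column v)\<bar> / 4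
       + (if column u = column v then 2 * ?h (column u) else 0))"
    by (intro sum.cong refl) (simp add: crossed_chain_resistance[OF assms])
  \<comment> \<open>Two distinct columns give four equal resistances. For \<open>a = b\<close> the
    two pairs of equal vertices give 0 and the two mate pairs give 4 \<open>?h a\<close> each, so
    the same formula covers the diagonal.\<close>
  also have "\<dots> = (\<Sum>a\<in>{1..n+1}. \<Sum>b\<in>{1..n+1}.
      4 * ?h a + 4 * ?h b + \<bar>real a - real b\<bar>)"
    unfolding sum_crossed_chain_verts sum.distrib[symmetric]
    by (intro sum.cong refl) auto
  also have "\<dots> = 8 * (real n + 1) * (\<Sum>a\<in>{1..n+1}. ?h a)
      + (\<Sum>a\<in>{1..n+1}. \<Sum>b\<in>{1..n+1}. \<bar>real a - real b\<bar>)"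
    unfolding sum.distrib sum_constant sum_distrib_left[symmetric]
    by (simp add: algebra_simps del: sum.cl_ivl_Suc)
  also have "\<dots> = 2 * ((real n + 1) * (real n + 2)^2 / 6)"
    unfolding sum_column_weight[OF assms] sum_abs_differences
    by (simp add: field_simps power2_eq_square power3_eq_cube)
  finally show ?thesis by simp
qed

end
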